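(* Let $\mu$ be a probability measure with full support on $\{\pm 1\}^n$ and let $C>0$. If the Glauber dynamics of $\mu$ has spectral gap $\frac{1}{Cn}$, then $\mu$ is $C$-spectrally independent, i.e. $\lambda_{\max}(\Psi)\le C$, where $\Psi$ is the $2n\times 2n$ correlation matrix of $\mu$.
   Context: The (discrete-time) Glauber dynamics for $\mu$ is the Markov chain on $\{\pm1\}^n$ which at each step selects $i\in\{1,\dots,n\}$ uniformly at random and resamples coordinate $\sigma_i$ from its conditional law under $\mu$ given the other coordinates $\sigma_{\sim i}=(\sigma_j)_{j\neq i}$ of the current state, leaving the other coordinates unchanged. If $P$ is its transition matrix, its spectral gap is $1-\lambda_2(P)$, where $\lambda_2(P)$ is the second largest eigenvalue of $P$. The correlation matrix $\Psi\in\mathbb{R}^{2n\times 2n}$ of $\mu$ is indexed by pairs in $[n]\times\{\pm1\}$ and has entries $$\Psi_{(i,\tau_i),(j,\tau_j)}=\mathbb{P}_{\sigma\sim\mu}[\sigma_i=\tau_i\mid \sigma_j=\tau_j]-\mathbb{P}_{\sigma\sim\mu}[\sigma_i=\tau_i].$$ $\mu$ is called $\eta$-spectrally independent if $\lambda_{\max}(\Psi)\le\eta$, where $\lambda_{\max}$ denotes the largest eigenvalue (the eigenvalues of $\Psi$ are real). *)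

theory Defs
  imports "HOL-Probability.Probability" "HOL-Computational_Algebra.Polynomial"
begin

section \<open>Eigenvalues of real square matrices\<close>

definition charpoly :: "real ^ 'k ^ 'k \<Rightarrow> real poly" where
  "charpoly A = det (mat [:0, 1:] - (\<chi> i j. [:A $ i $ j:]))"

text \<open>
  The real eigenvalues, listed in decreasing order and repeated according to algebraic
  multiplicity. The Glauber and correlation matrices of \<open>\<mu>\<close> below are similar to symmetric ones when \<open>\<mu>\<close> has full support,
  so that no eigenvalue is lost by restricting to the reals.
\<close>

definition eigenvalues :: "real ^ 'k ^ 'k \<Rightarrow> real list" where
  "eigenvalues A = rev (sorted_list_of_multiset (proots (charpoly A)))"

definition largest_eigenvalue :: "real ^ 'k ^ 'k \<Rightarrow> real" where
  "largest_eigenvalue A = eigenvalues A ! 0"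

definition second_largest_eigenvalue :: "real ^ 'k ^ 'k \<Rightarrow> real" where
  "second_largest_eigenvalue A = eigenvalues A ! 1"

lemma poly_charpoly: "poly (charpoly A) x = det (mat x - A)"
  by (simp add: charpoly_def det_def poly_sum poly_prod mat_def if_distrib [of "\<lambda>p. poly p x"]
      cong: if_cong)

lemma poly_charpoly_eq_0_iff:
  "poly (charpoly A) x = 0 \<longleftrightarrow> (\<exists>v. v \<noteq> 0 \<and> A *v v = x *s v)"
proof -
  have mat_mult: "mat x *v v = x *s v" for v :: "real ^ 'k"
    by (simp add: vec_eq_iff mat_def matrix_vector_mult_def if_distrib [of "\<lambda>a. a * _"]
        cong: if_cong)
  have "poly (charpoly A) x = 0 \<longleftrightarrow> \<not> invertible (mat x - A)"
    by (simp add: poly_charpoly invertible_det_nz)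
  also have "\<dots> \<longleftrightarrow> (\<exists>v. v \<noteq> 0 \<and> (mat x - A) *v v = 0)"
    by (auto simp: invertible_left_inverse matrix_left_invertible_ker)
  also have "\<dots> \<longleftrightarrow> (\<exists>v. v \<noteq> 0 \<and> A *v v = x *s v)"
    by (auto simp: matrix_vector_mult_diff_rdistrib mat_mult)
  finally show ?thesis .
qed

lemma charpoly_nonzero: "charpoly A \<noteq> 0"
proof
  assume "charpoly A = 0"
  obtain K where K: "\<And>v. norm (A *v v) \<le> norm v * K"
    using bounded_linear.bounded [OF matrix_vector_mul_bounded_linear [of A]] by blast
  define x where "x = \<bar>K\<bar> + 1"
  have "poly (charpoly A) x = 0"
    using \<open>charpoly A = 0\<close> by simp
  then obtain v where v: "v \<noteq> 0" "A *v v = x *s v"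
    by (auto simp: poly_charpoly_eq_0_iff)
  have "x * norm v \<le> K * norm v"
    using K [of v] v by (simp add: x_def scalar_mult_eq_scaleR mult.commute)
  then show False
    using v(1) by (simp add: x_def)
qed

lemma set_eigenvalues: "set (eigenvalues A) = {x. \<exists>v. v \<noteq> 0 \<and> A *v v = x *s v}"
  by (simp add: eigenvalues_def charpoly_nonzero poly_charpoly_eq_0_iff)


section \<open>Spin systems\<close>

typedef spin = "{-1, 1 :: int}"
  by blast

instance spin :: finite
proof
  have "(UNIV :: spin set) = Abs_spin ` {-1, 1}"
    using type_definition.Abs_image [OF type_definition_spin] by simp
  then show "finite (UNIV :: spin set)"
    by (metis finite.emptyI finite.insertI finite_imageI)
qed

text \<open>
  Configurations are functions \<open>'n \<Rightarrow> spin\<close>, where \<open>'n\<close> is a finite type with \<open>n = CARD('n)\<close> elements.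
\<close>

definition glauber_step :: "('n::finite \<Rightarrow> spin) pmf \<Rightarrow> ('n \<Rightarrow> spin) \<Rightarrow> ('n \<Rightarrow> spin) pmf" where
  "glauber_step \<mu> \<sigma> =
     bind_pmf (pmf_of_set UNIV) (\<lambda>i.
     bind_pmf (map_pmf (\<lambda>\<tau>. \<tau> i) (cond_pmf \<mu> {\<tau>. \<forall>j. j \<noteq> i \<longrightarrow> \<tau> j = \<sigma> j})) (\<lambda>s.
     return_pmf (\<sigma>(i := s))))"

definition glauber_matrix ::
    "('n::finite \<Rightarrow> spin) pmf \<Rightarrow> real ^ ('n \<Rightarrow> spin) ^ ('n \<Rightarrow> spin)" where
  "glauber_matrix \<mu> = (\<chi> \<sigma> \<tau>. pmf (glauber_step \<mu> \<sigma>) \<tau>)"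

definition spectral_gap :: "real ^ 'k ^ 'k \<Rightarrow> real" where
  "spectral_gap P = 1 - second_largest_eigenvalue P"

definition correlation_matrix ::
    "('n::finite \<Rightarrow> spin) pmf \<Rightarrow> real ^ ('n \<times> spin) ^ ('n \<times> spin)" where
  "correlation_matrix \<mu> = (\<chi> p q.
     case p of (i, s) \<Rightarrow> case q of (j, t) \<Rightarrow>
       \<P>(\<sigma> in measure_pmf \<mu>. \<sigma> i = s \<bar> \<sigma> j = t) - \<P>(\<sigma> in measure_pmf \<mu>. \<sigma> i = s))"

definition spectrally_independent :: "real \<Rightarrow> ('n::finite \<Rightarrow> spin) pmf \<Rightarrow> bool" where
  "spectrally_independent \<eta> \<mu> \<longleftrightarrow> largest_eigenvalue (correlation_matrix \<mu>) \<le> \<eta>"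

end

theory Submission
  imports Defs
begin

text \<open>
  Let \<open>D\<close> be the diagonal matrix of the probabilities \<open>P[\<sigma>\<^sub>j = t]\<close>. Then \<open>\<Psi> D\<close> is the covariance matrix
  of the indicators of the events \<open>\<sigma>\<^sub>j = t\<close>. An eigenvector \<open>v\<close> of \<open>\<Psi>\<close> with eigenvalue \<open>\<theta>\<close> gives
  coefficients \<open>a = D\<inverse> v\<close> and a test function \<open>f(\<sigma>) = \<Sum>\<^sub>j a(j, \<sigma>\<^sub>j)\<close> with
  \<open>Var f = \<theta> \<Sum>\<^sub>j E[a(j, \<sigma>\<^sub>j)\<^sup>2]\<close>, by \<open>ip_linear_statistic_eigenvector\<close>.

  This test function is fed into the Poincare inequality \<open>gap \<cdot> Var f \<le> \<langle>f, (1 - P) f\<rangle>\<close> of the Glauber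
  dynamics. Its right-hand side is the average over \<open>j\<close> of the expected conditional variance of \<open>f\<close>
  given all spins except \<open>\<sigma>\<^sub>j\<close>. In that conditional variance all summands of \<open>f\<close> but the \<open>j\<close>-th are
  constants, so it is at most \<open>E[a(j, \<sigma>\<^sub>j)\<^sup>2]\<close> (\<open>linear_statistic_dirichlet_le\<close>). Therefore
  \<open>gap \<cdot> \<theta> S \<le> S / n\<close> with \<open>S = \<Sum>\<^sub>j E[a(j, \<sigma>\<^sub>j)\<^sup>2] > 0\<close>, which for \<open>gap = 1 / (C n)\<close> says \<open>\<theta> \<le> C\<close>.

  The Poincare inequality (\<open>poincare_inequality\<close>) is proved for every finite reversible chain in which
  only the constants have zero Dirichlet form: the maximum of the Rayleigh quotient over the functions
  of mean zero is an eigenvalue smaller than 1, hence at most the second largest one. Full support of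
  \<open>\<mu>\<close> makes the weights of the inner product positive and the Glauber dynamics irreducible.
\<close>

section \<open>The second entry of the eigenvalue list\<close>

text \<open>
  In a decreasing list an entry below some other entry cannot come first. Comparing two
  distinct eigenvalues reduces the position in the list to membership, without any count of
  multiplicities.
\<close>

lemma le_second_largest_eigenvalue:
  assumes "x \<in> set (eigenvalues A)" "y \<in> set (eigenvalues A)" "x < y"
  shows "x \<le> second_largest_eigenvalue A"
proof -
  define l where "l = eigenvalues A"
  have anti: "l ! j \<le> l ! i" if "i \<le> j" "j < length l" for i j
  proof -
    have "sorted (rev l)" by (simp add: l_def eigenvalues_def)
    then show ?thesis using that by (metis sorted_rev_nth_mono)
  qed
  obtain k m where k: "k < length l" "l ! k = x" and m: "m < length l" "l ! m = y"
    using assms(1,2) by (metis l_def in_set_conv_nth)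
  have "k \<noteq> 0"
  proof
    assume "k = 0"
    then show False using anti [of 0 m] k m \<open>x < y\<close> by simp
  qed
  then show ?thesis
    using anti [of 1 k] k by (simp add: second_largest_eigenvalue_def l_def)
qed

section \<open>Weighted inner products\<close>

definition weighted_inner :: "('k::finite \<Rightarrow> real) \<Rightarrow> real ^ 'k \<Rightarrow> real ^ 'k \<Rightarrow> real" where
  "weighted_inner w f g = (\<Sum>x\<in>UNIV. w x * f $ x * g $ x)"

lemma weighted_inner_commute: "weighted_inner w f g = weighted_inner w g f"
  by (simp add: weighted_inner_def mult_ac)

lemma weighted_inner_add_left:
    "weighted_inner w (f + g) h =
      weighted_inner w f h + weighted_inner w g h"
  and weighted_inner_diff_left:
    "weighted_inner w (f - g) h =
      weighted_inner w f h - weighted_inner w g h"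
  and weighted_inner_scale_left: "weighted_inner w (c *s f) h = c * weighted_inner w f h"
  by (simp_all add: weighted_inner_def algebra_simps sum.distrib sum_subtractf sum_distrib_left)

lemma weighted_inner_add_right:
    "weighted_inner w h (f + g) =
      weighted_inner w h f + weighted_inner w h g"
  and weighted_inner_diff_right:
    "weighted_inner w h (f - g) =
      weighted_inner w h f - weighted_inner w h g"
  and weighted_inner_scale_right: "weighted_inner w h (c *s f) = c * weighted_inner w h f"
  by (simp_all add: weighted_inner_commute [of w h] weighted_inner_add_left
      weighted_inner_diff_left weighted_inner_scale_left)

lemma weighted_inner_sum_left:
  "weighted_inner w (\<Sum>i\<in>I. f i) h = (\<Sum>i\<in>I. weighted_inner w (f i) h)"
  by (induction I rule: infinite_finite_induct)
    (simp_all add: weighted_inner_add_left, simp_all add: weighted_inner_def)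

lemma weighted_inner_sum_right:
  "weighted_inner w h (\<Sum>i\<in>I. f i) = (\<Sum>i\<in>I. weighted_inner w h (f i))"
  by (simp add: weighted_inner_commute [of w h] weighted_inner_sum_left)

lemmas weighted_inner_simps =
  weighted_inner_add_left weighted_inner_diff_left weighted_inner_scale_left
  weighted_inner_add_right weighted_inner_diff_right weighted_inner_scale_right

section \<open>Reversible Markov chains and the Poincare inequality\<close>

text \<open>
  First variation: near \<open>t = 0\<close> a quadratic term cannot dominate a linear one.
\<close>

lemma nonpos_if_linear_le_quadratic:
  fixes a b :: real
  assumes "\<And>t. 2 * t * a \<le> t\<^sup>2 * b"
  shows "a \<le> 0"
proof (rule ccontr)
  assume "\<not> a \<le> 0"
  then have a: "a > 0" by simp
  define t where "t = a / (\<bar>b\<bar> + 1)"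
  have t: "t > 0" using a by (simp add: t_def add_nonneg_pos)
  have "t * (2 * a) \<le> t * (t * b)"
    using assms [of t] by (simp add: power2_eq_square mult_ac)
  then have "2 * a \<le> t * b" using t by simp
  also have "\<dots> \<le> t * (\<bar>b\<bar> + 1)" using t by (intro mult_left_mono) auto
  also have "\<dots> = a" by (simp add: t_def)
  finally show False using a by simp
qed

locale reversible_chain =
  fixes P :: "real ^ 'k ^ 'k" and w :: "'k \<Rightarrow> real"
  assumes weight_pos: "0 < w x"
    and reversible: "w x * P $ x $ y = w y * P $ y $ x"
    and row_sum: "(\<Sum>y\<in>UNIV. P $ x $ y) = 1"
begin

abbreviation ip :: "real ^ 'k \<Rightarrow> real ^ 'k \<Rightarrow> real" where
  "ip \<equiv> weighted_inner w"

lemma ip_nonneg: "0 \<le> ip f f"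
  unfolding weighted_inner_def by (intro sum_nonneg) (simp add: mult.assoc less_imp_le [OF weight_pos])

lemma ip_eq_0_iff: "ip f f = 0 \<longleftrightarrow> f = 0"
proof
  assume "ip f f = 0"
  then have "\<forall>x\<in>UNIV. w x * f $ x * f $ x = 0"
    unfolding weighted_inner_def
    by (subst sum_nonneg_eq_0_iff [symmetric]) (auto simp: mult.assoc less_imp_le [OF weight_pos])
  then show "f = 0" using weight_pos by (auto simp: vec_eq_iff less_le)
qed (simp add: weighted_inner_def)

lemma ip_pos: "f \<noteq> 0 \<Longrightarrow> 0 < ip f f"
  using ip_nonneg [of f] ip_eq_0_iff [of f] by linarith

lemma self_adjoint: "ip (P *v f) g = ip f (P *v g)"
proof -
  have "ip (P *v f) g = (\<Sum>x\<in>UNIV. \<Sum>y\<in>UNIV. (w x * P $ x $ y) * f $ y * g $ x)"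
    by (simp add: weighted_inner_def matrix_vector_mult_def sum_distrib_left sum_distrib_right mult_ac)
  also have "\<dots> = (\<Sum>x\<in>UNIV. \<Sum>y\<in>UNIV. (w y * P $ y $ x) * f $ y * g $ x)"
    by (subst reversible) simp
  also have "\<dots> = (\<Sum>y\<in>UNIV. \<Sum>x\<in>UNIV. (w y * P $ y $ x) * f $ y * g $ x)"
    by (rule sum.swap)
  also have "\<dots> = ip f (P *v g)"
    by (simp add: weighted_inner_def matrix_vector_mult_def sum_distrib_left sum_distrib_right mult_ac)
  finally show ?thesis .
qed

lemma const_invariant: "P *v 1 = 1"
  by (simp add: vec_eq_iff matrix_vector_mult_def row_sum)

text \<open>
  The Dirichlet form sees only differences of \<open>f\<close> along transitions. From this form one reads off that
  it is nonnegative, when it vanishes, and that it depends only on the increments of \<open>f\<close>.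
\<close>

lemma dirichlet_form:
  "ip f (f - P *v f) =
     (\<Sum>x\<in>UNIV. \<Sum>y\<in>UNIV. w x * P $ x $ y * (f $ x - f $ y)\<^sup>2) / 2"
proof -
  have diag: "(\<Sum>x\<in>UNIV. \<Sum>y\<in>UNIV. w x * P $ x $ y * (f $ x)\<^sup>2) = ip f f"
    unfolding weighted_inner_def
  proof (rule sum.cong [OF refl])
    fix x
    have "(\<Sum>y\<in>UNIV. w x * P $ x $ y * (f $ x)\<^sup>2) = (\<Sum>y\<in>UNIV. P $ x $ y) * (w x * (f $ x)\<^sup>2)"
      by (simp add: sum_distrib_right sum_distrib_left mult_ac)
    then show "(\<Sum>y\<in>UNIV. w x * P $ x $ y * (f $ x)\<^sup>2) = w x * f $ x * f $ x"
      by (simp add: row_sum power2_eq_square)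
  qed
  have "(\<Sum>x\<in>UNIV. \<Sum>y\<in>UNIV. w x * P $ x $ y * (f $ y)\<^sup>2) =
      (\<Sum>y\<in>UNIV. \<Sum>x\<in>UNIV. w x * P $ x $ y * (f $ y)\<^sup>2)"
    by (rule sum.swap)
  also have "\<dots> = (\<Sum>y\<in>UNIV. \<Sum>x\<in>UNIV. w y * P $ y $ x * (f $ y)\<^sup>2)"
    by (subst reversible) simp
  finally have diag': "(\<Sum>x\<in>UNIV. \<Sum>y\<in>UNIV. w x * P $ x $ y * (f $ y)\<^sup>2) = ip f f"
    using diag by simp
  have cross: "(\<Sum>x\<in>UNIV. \<Sum>y\<in>UNIV. w x * P $ x $ y * (f $ x * f $ y)) = ip f (P *v f)"
    by (simp add: weighted_inner_def matrix_vector_mult_def sum_distrib_left mult_ac)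
  have square: "w x * P $ x $ y * (f $ x - f $ y)\<^sup>2 = w x * P $ x $ y * (f $ x)\<^sup>2
      + w x * P $ x $ y * (f $ y)\<^sup>2 - 2 * (w x * P $ x $ y * (f $ x * f $ y))" for x y
    by (simp add: power2_eq_square algebra_simps)
  have "(\<Sum>x\<in>UNIV. \<Sum>y\<in>UNIV. w x * P $ x $ y * (f $ x - f $ y)\<^sup>2) =
      ip f f + ip f f - 2 * ip f (P *v f)"
    unfolding square sum.distrib sum_subtractf sum_distrib_left [symmetric] diag diag' cross ..
  then show ?thesis
    by (simp add: weighted_inner_simps)
qed

lemma compact_unit_sphere: "compact {f. ip f f = 1 \<and> ip 1 f = 0}"
proof -
  have cont: "continuous_on UNIV (\<lambda>f. ip f f)" "continuous_on UNIV (\<lambda>f. ip 1 f)"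
    unfolding weighted_inner_def by (intro continuous_intros)+
  have "closed ({f. ip f f = 1} \<inter> {f. ip 1 f = 0})"
    by (intro closed_Int closed_Collect_eq cont continuous_on_const)
  moreover have "bounded ({f. ip f f = 1} \<inter> {f. ip 1 f = 0})"
  proof -
    define m where "m = Min (range w)"
    have m: "m > 0" "\<And>x. m \<le> w x"
      using weight_pos by (auto simp: m_def)
    have "norm f \<le> sqrt (1 / m)" if "ip f f = 1" for f
    proof -
      have "m * (norm f)\<^sup>2 = (\<Sum>x\<in>UNIV. m * (f $ x * f $ x))"
        by (simp add: power2_norm_eq_inner inner_vec_def sum_distrib_left)
      also have "\<dots> \<le> (\<Sum>x\<in>UNIV. w x * (f $ x * f $ x))"
        by (intro sum_mono mult_right_mono m) auto
      also have "\<dots> = 1"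
        using that by (simp add: weighted_inner_def mult.assoc)
      finally show ?thesis
        using m(1) by (intro real_le_rsqrt) (simp add: field_simps)
    qed
    then show ?thesis by (auto intro!: boundedI)
  qed
  ultimately show ?thesis
    by (simp add: compact_eq_bounded_closed Collect_conj_eq)
qed

text \<open>
  A maximizer \<open>g\<close> of the Rayleigh quotient of \<open>P\<close> over the mean-zero functions is an eigenvector: the
  residual \<open>r = P g - \<rho> g\<close> has mean zero because \<open>P\<close> is self-adjoint and fixes the constants, so it is
  an admissible direction in which to perturb \<open>g\<close>, and the first variation in that direction,
  \<open>2 \<langle>r, r\<rangle>\<close>, must vanish. The given \<open>f\<close> guarantees that there is a nonzero mean-zero function
  at all.
\<close>

lemma extremal_eigenvector:
  assumes "f \<noteq> 0" "ip 1 f = 0"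
  obtains \<rho> g where "g \<noteq> 0" "ip 1 g = 0" "P *v g = \<rho> *s g" "ip f (P *v f) \<le> \<rho> * ip f f"
proof -
  let ?S = "{f. ip f f = 1 \<and> ip 1 f = 0}"
  have normalize: "inverse (sqrt (ip h h)) *s h \<in> ?S" if "h \<noteq> 0" "ip 1 h = 0" for h
    using ip_pos [OF that(1)] that(2) by (simp add: weighted_inner_simps field_simps)
  have "continuous_on ?S (\<lambda>f. ip f (P *v f))"
    unfolding weighted_inner_def matrix_vector_mult_def by (intro continuous_intros)
  moreover have "?S \<noteq> {}" using normalize [OF assms] by blast
  ultimately obtain g where g: "g \<in> ?S" and max: "\<And>h. h \<in> ?S \<Longrightarrow> ip h (P *v h) \<le> ip g (P *v g)"
    using continuous_attains_sup [OF compact_unit_sphere] by blast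
  define \<rho> where "\<rho> = ip g (P *v g)"
  have rayleigh: "ip h (P *v h) \<le> \<rho> * ip h h" if "ip 1 h = 0" for h
  proof (cases "h = 0")
    case False
    show ?thesis
      using max [OF normalize [OF False that]] ip_pos [OF False]
      by (simp add: weighted_inner_simps matrix_vector_mult_scaleR scalar_mult_eq_scaleR [symmetric]
          vector_scalar_commute \<rho>_def field_simps)
  qed (simp add: weighted_inner_def)
  define r where "r = P *v g - \<rho> *s g"
  have r0: "ip 1 r = 0"
    using g by (simp add: r_def weighted_inner_simps self_adjoint [symmetric] const_invariant)
  have Pg: "P *v g = r + \<rho> *s g" by (simp add: r_def)
  have gr: "ip g r = 0" "ip r g = 0"
    using g by (simp_all add: weighted_inner_commute [of w r g])
      (simp_all add: r_def weighted_inner_simps \<rho>_def)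
  have gPr: "ip g (P *v r) = ip r r"
    using self_adjoint [of g r] by (simp add: Pg weighted_inner_simps gr)
  have "ip r r \<le> 0"
  proof (rule nonpos_if_linear_le_quadratic)
    fix t
    have "P *v (g + t *s r) = r + \<rho> *s g + t *s (P *v r)"
      by (simp add: matrix_vector_right_distrib vector_scalar_commute Pg)
    then have "ip (g + t *s r) (P *v (g + t *s r)) = \<rho> + 2 * t * ip r r + t\<^sup>2 * ip r (P *v r)"
      using g by (simp add: weighted_inner_simps gr gPr power2_eq_square algebra_simps)
    moreover have "ip (g + t *s r) (g + t *s r) = 1 + t\<^sup>2 * ip r r"
      using g by (simp add: weighted_inner_simps gr power2_eq_square)
    moreover have "ip 1 (g + t *s r) = 0"
      using g r0 by (simp add: weighted_inner_simps)
    ultimately show "2 * t * ip r r \<le> t\<^sup>2 * (\<rho> * ip r r - ip r (P *v r))"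
      using rayleigh [of "g + t *s r"] by (simp add: algebra_simps)
  qed
  then have "r = 0" using ip_pos [of r] by force
  then have "P *v g = \<rho> *s g" by (simp add: r_def)
  moreover have "g \<noteq> 0" using g by (auto simp: weighted_inner_def)
  ultimately show ?thesis
    using that [of g \<rho>] g rayleigh [OF assms(2)] by blast
qed

text \<open>
  The extremal eigenvalue \<open>\<rho>\<close> on the mean-zero functions is below the eigenvalue 1 of the constants,
  since otherwise its eigenvector would have nonpositive Dirichlet form and hence be constant. So \<open>1\<close>
  and \<open>\<rho>\<close> are two different eigenvalues and \<open>\<rho>\<close> is at most the second largest one.
\<close>

lemma poincare_inequality:
  assumes irreducible: "\<And>g. ip g (g - P *v g) \<le> 0 \<Longrightarrow> \<exists>c. g = c *s 1"
    and "ip 1 f = 0"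
  shows "spectral_gap P * ip f f \<le> ip f (f - P *v f)"
proof (cases "f = 0")
  case False
  obtain \<rho> g where g: "g \<noteq> 0" "ip 1 g = 0" "P *v g = \<rho> *s g"
    and \<rho>: "ip f (P *v f) \<le> \<rho> * ip f f"
    using extremal_eigenvector [OF False assms(2)] by blast
  have "\<rho> < 1"
  proof (rule ccontr)
    assume "\<not> \<rho> < 1"
    then have "(1 - \<rho>) * ip g g \<le> 0"
      by (intro mult_nonpos_nonneg ip_nonneg) simp
    then have "ip g (g - P *v g) \<le> 0"
      by (simp add: g(3) weighted_inner_simps algebra_simps)
    then obtain c where c: "g = c *s 1" using irreducible by blast
    have "ip g g = c * ip 1 g" by (subst c) (simp add: weighted_inner_simps)
    then show False using g ip_eq_0_iff by simp
  qed
  moreover have "1 \<in> set (eigenvalues P)"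
    unfolding set_eigenvalues using const_invariant by (auto intro!: exI [of _ "1 :: real ^ 'k"])
  moreover have "\<rho> \<in> set (eigenvalues P)"
    unfolding set_eigenvalues using g by blast
  ultimately have "\<rho> \<le> second_largest_eigenvalue P"
    by (intro le_second_largest_eigenvalue)
  then have "\<rho> * ip f f \<le> second_largest_eigenvalue P * ip f f"
    by (intro mult_right_mono ip_nonneg)
  then show ?thesis
    using \<rho> by (simp add: spectral_gap_def weighted_inner_simps algebra_simps)
qed (simp add: weighted_inner_def)

end

section \<open>Glauber dynamics as an average of conditional expectations\<close>

locale full_support =
  fixes \<mu> :: "('n::finite \<Rightarrow> spin) pmf"
  assumes full_support: "set_pmf \<mu> = UNIV"
begin

abbreviation ip :: "real ^ ('n \<Rightarrow> spin) \<Rightarrow> real ^ ('n \<Rightarrow> spin) \<Rightarrow> real" where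
  "ip \<equiv> weighted_inner (pmf \<mu>)"

lemma pmf_pos: "0 < pmf \<mu> \<sigma>"
  using full_support by (simp add: pmf_positive_iff)

lemma sum_pmf: "(\<Sum>\<sigma>\<in>UNIV. pmf \<mu> \<sigma>) = 1"
  by (simp add: sum_pmf_eq_1)

definition agree_off :: "'n \<Rightarrow> ('n \<Rightarrow> spin) \<Rightarrow> ('n \<Rightarrow> spin) set" where
  "agree_off i \<sigma> = {\<tau>. \<forall>j. j \<noteq> i \<longrightarrow> \<tau> j = \<sigma> j}"

lemma agree_off_refl: "\<sigma> \<in> agree_off i \<sigma>"
  by (simp add: agree_off_def)

lemma agree_off_sym: "\<tau> \<in> agree_off i \<sigma> \<longleftrightarrow> \<sigma> \<in> agree_off i \<tau>"
  by (auto simp: agree_off_def)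

lemma agree_off_eq: "\<tau> \<in> agree_off i \<sigma> \<Longrightarrow> agree_off i \<tau> = agree_off i \<sigma>"
  by (auto simp: agree_off_def)

text \<open>
  Acting on functions, this matrix is the conditional expectation given all spins but the \<open>i\<close>-th.
\<close>

definition resample :: "'n \<Rightarrow> real ^ ('n \<Rightarrow> spin) ^ ('n \<Rightarrow> spin)" where
  "resample i = (\<chi> \<sigma> \<tau>. pmf (cond_pmf \<mu> (agree_off i \<sigma>)) \<tau>)"

lemma resample_nth:
  "resample i $ \<sigma> $ \<tau> =
     (if \<tau> \<in> agree_off i \<sigma> then pmf \<mu> \<tau> / measure_pmf.prob \<mu> (agree_off i \<sigma>) else 0)"
  unfolding resample_def
  using agree_off_refl [of \<sigma> i]
  by (subst vec_lambda_beta, subst vec_lambda_beta, subst pmf_cond) (auto simp: full_support)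

lemma prob_agree_off_pos: "0 < measure_pmf.prob \<mu> (agree_off i \<sigma>)"
  using agree_off_refl [of \<sigma> i] by (auto simp: measure_pmf_posI full_support)

lemma resample_nonneg: "0 \<le> resample i $ \<sigma> $ \<tau>"
  by (simp add: resample_def)

lemma resample_pos: "\<tau> \<in> agree_off i \<sigma> \<Longrightarrow> 0 < resample i $ \<sigma> $ \<tau>"
  using pmf_pos [of \<tau>] prob_agree_off_pos [of i \<sigma>]
  by (simp only: resample_nth if_True divide_pos_pos)

sublocale resample: reversible_chain "resample i" "pmf \<mu>" for i
proof
  fix \<sigma> \<tau>
  show "0 < pmf \<mu> \<sigma>" by (rule pmf_pos)
  show "pmf \<mu> \<sigma> * resample i $ \<sigma> $ \<tau> = pmf \<mu> \<tau> * resample i $ \<tau> $ \<sigma>"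
    using agree_off_eq [of \<tau> i \<sigma>] agree_off_sym [of \<tau> i \<sigma>] by (simp add: resample_nth)
  show "(\<Sum>\<tau>\<in>UNIV. resample i $ \<sigma> $ \<tau>) = 1"
    by (simp add: resample_def sum_pmf_eq_1)
qed

text \<open>
  After resampling spin \<open>i\<close>, a function no longer depends on that spin.
\<close>

lemma resample_idem: "resample i *v (resample i *v f) = resample i *v f"
proof -
  have "(\<Sum>\<tau>\<in>UNIV. resample i $ \<sigma> $ \<tau> * (resample i *v f) $ \<tau>)
      = (\<Sum>\<tau>\<in>UNIV. resample i $ \<sigma> $ \<tau> * (resample i *v f) $ \<sigma>)" for \<sigma>
  proof (rule sum.cong [OF refl])
    fix \<tau>
    have "resample i $ \<tau> = resample i $ \<sigma>" if "\<tau> \<in> agree_off i \<sigma>"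
      using agree_off_eq [OF that] by (simp add: resample_def)
    then show "resample i $ \<sigma> $ \<tau> * (resample i *v f) $ \<tau> =
        resample i $ \<sigma> $ \<tau> * (resample i *v f) $ \<sigma>"
      by (cases "\<tau> \<in> agree_off i \<sigma>") (simp_all add: matrix_vector_mult_def, simp add: resample_nth)
  qed
  then have "(\<Sum>\<tau>\<in>UNIV. resample i $ \<sigma> $ \<tau> * (resample i *v f) $ \<tau>) = (resample i *v f) $ \<sigma>" for \<sigma>
    by (simp add: sum_distrib_right [symmetric] resample.row_sum)
  then show ?thesis
    by (simp add: vec_eq_iff matrix_vector_mult_def [of _ "resample i *v f"])
qed

text \<open>
  A conditional variance is at most the second moment: as an orthogonal projection, resampling is
  positive semidefinite. Bounding the squared increments by \<open>(x - y)\<^sup>2 \<le> 2 x\<^sup>2 + 2 y\<^sup>2\<close> instead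
  would lose a factor 2.
\<close>

lemma resample_dirichlet_le: "ip f (f - resample i *v f) \<le> ip f f"
proof -
  have "ip f (resample i *v f) = ip (resample i *v f) (resample i *v f)"
    by (simp add: resample.self_adjoint resample_idem)
  then show ?thesis
    using resample.ip_nonneg [of "resample i *v f"] by (simp add: weighted_inner_simps)
qed

lemma resample_dirichlet_cong:
  assumes "\<And>\<sigma> \<tau>. \<tau> \<in> agree_off i \<sigma> \<Longrightarrow> f $ \<sigma> - f $ \<tau> = g $ \<sigma> - g $ \<tau>"
  shows "ip f (f - resample i *v f) = ip g (g - resample i *v g)"
  unfolding resample.dirichlet_form
  by (intro arg_cong2 [where f = "(/)"] sum.cong refl) (auto simp: resample_nth assms)

lemma resample_dirichlet_nonneg: "0 \<le> ip f (f - resample i *v f)"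
  unfolding resample.dirichlet_form
  by (intro divide_nonneg_pos sum_nonneg) (auto simp: resample_nonneg)

lemma resample_dirichlet_eq_0:
  assumes "ip f (f - resample i *v f) = 0" "\<tau> \<in> agree_off i \<sigma>"
  shows "f $ \<tau> = f $ \<sigma>"
proof -
  have "(\<Sum>\<tau>\<in>UNIV. pmf \<mu> \<sigma> * resample i $ \<sigma> $ \<tau> * (f $ \<sigma> - f $ \<tau>)\<^sup>2) = 0"
    using assms(1) unfolding resample.dirichlet_form
    by (subst (asm) divide_eq_0_iff, subst (asm) sum_nonneg_eq_0_iff)
       (auto intro!: sum_nonneg simp: resample_nonneg)
  then have "pmf \<mu> \<sigma> * resample i $ \<sigma> $ \<tau> * (f $ \<sigma> - f $ \<tau>)\<^sup>2 = 0"
    by (subst (asm) sum_nonneg_eq_0_iff) (auto simp: resample_nonneg)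
  then show ?thesis
    using pmf_pos [of \<sigma>] resample_pos [OF assms(2)] by simp
qed

text \<open>
  Any two configurations are joined by changing one spin at a time, through configurations that all
  have positive probability.
\<close>

lemma const_if_resample_invariant:
  fixes f :: "real ^ ('n \<Rightarrow> spin)"
  assumes "\<And>i \<sigma> \<tau>. \<tau> \<in> agree_off i \<sigma> \<Longrightarrow> f $ \<tau> = f $ \<sigma>"
  shows "\<exists>c. f = c *s 1"
proof -
  have eq: "f $ (\<lambda>j. if j \<in> S then \<tau> j else \<sigma> j) = f $ \<sigma>" if "finite S" for S \<sigma> \<tau>
    using that
  proof (induction S)
    case (insert i S)
    have "f $ (\<lambda>j. if j \<in> insert i S then \<tau> j else \<sigma> j) = f $ (\<lambda>j. if j \<in> S then \<tau> j else \<sigma> j)"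
      by (rule assms [where i = i]) (auto simp: agree_off_def)
    then show ?case using insert.IH by simp
  qed simp
  have "f $ \<tau> = f $ \<sigma>" for \<sigma> \<tau>
    using eq [of UNIV \<tau> \<sigma>] by simp
  then have "f = f $ undefined *s 1"
    by (auto simp: vec_eq_iff)
  then show ?thesis by blast
qed

text \<open>
  A sample from \<open>\<mu>\<close> conditioned to agree with \<open>\<sigma>\<close> off \<open>i\<close> is already the updated configuration, so
  that extracting its \<open>i\<close>-th spin and writing it into \<open>\<sigma>\<close> changes nothing.
\<close>

lemma glauber_step_eq:
  "glauber_step \<mu> \<sigma> = bind_pmf (pmf_of_set UNIV) (\<lambda>i. cond_pmf \<mu> (agree_off i \<sigma>))"
proof -
  have "map_pmf (\<lambda>\<tau>. \<sigma>(i := \<tau> i)) (cond_pmf \<mu> (agree_off i \<sigma>)) = cond_pmf \<mu> (agree_off i \<sigma>)" for i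
  proof -
    have "\<sigma>(i := \<tau> i) = \<tau>" if "\<tau> \<in> set_pmf (cond_pmf \<mu> (agree_off i \<sigma>))" for \<tau>
      using that agree_off_refl [of \<sigma> i]
      by (subst (asm) set_cond_pmf) (auto simp: full_support agree_off_def)
    then have "map_pmf (\<lambda>\<tau>. \<sigma>(i := \<tau> i)) (cond_pmf \<mu> (agree_off i \<sigma>)) =
        map_pmf (\<lambda>\<tau>. \<tau>) (cond_pmf \<mu> (agree_off i \<sigma>))"
      by (intro map_pmf_cong refl)
    then show ?thesis by simp
  qed
  then show ?thesis
    by (simp add: glauber_step_def map_pmf_def [symmetric] map_pmf_comp agree_off_def)
qed

lemma glauber_matrix_nth:
  "glauber_matrix \<mu> $ \<sigma> $ \<tau> = (\<Sum>i\<in>UNIV. resample i $ \<sigma> $ \<tau>) / real CARD('n)"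
  by (simp add: glauber_matrix_def glauber_step_eq pmf_bind_pmf_of_set resample_def)

sublocale glauber: reversible_chain "glauber_matrix \<mu>" "pmf \<mu>"
proof
  fix \<sigma> \<tau>
  show "0 < pmf \<mu> \<sigma>" by (rule pmf_pos)
  show "pmf \<mu> \<sigma> * glauber_matrix \<mu> $ \<sigma> $ \<tau> = pmf \<mu> \<tau> * glauber_matrix \<mu> $ \<tau> $ \<sigma>"
    by (simp add: glauber_matrix_nth sum_distrib_left resample.reversible [of \<sigma> _ \<tau>])
  show "(\<Sum>\<tau>\<in>UNIV. glauber_matrix \<mu> $ \<sigma> $ \<tau>) = 1"
    by (simp add: glauber_matrix_def sum_pmf_eq_1)
qed

lemma glauber_dirichlet:
  "ip f (f - glauber_matrix \<mu> *v f) =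
     (\<Sum>i\<in>UNIV. ip f (f - resample i *v f)) / real CARD('n)"
proof -
  let ?D = "\<lambda>i \<sigma> \<tau>. pmf \<mu> \<sigma> * resample i $ \<sigma> $ \<tau> * (f $ \<sigma> - f $ \<tau>)\<^sup>2"
  have "pmf \<mu> \<sigma> * glauber_matrix \<mu> $ \<sigma> $ \<tau> * (f $ \<sigma> - f $ \<tau>)\<^sup>2 =
      (\<Sum>i\<in>UNIV. ?D i \<sigma> \<tau>) / real CARD('n)" for \<sigma> \<tau>
    by (simp add: glauber_matrix_nth sum_distrib_left sum_distrib_right)
  moreover have "(\<Sum>\<sigma>\<in>UNIV. \<Sum>\<tau>\<in>UNIV. \<Sum>i\<in>UNIV. ?D i \<sigma> \<tau>) =
      (\<Sum>i\<in>UNIV. \<Sum>\<sigma>\<in>UNIV. \<Sum>\<tau>\<in>UNIV. ?D i \<sigma> \<tau>)"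
    by (subst sum.swap [where B = "UNIV :: 'n set"],
        subst sum.swap [where B = "UNIV :: 'n set"], rule refl)
  ultimately show ?thesis
    unfolding glauber.dirichlet_form resample.dirichlet_form
    by (simp only: sum_divide_distrib [symmetric]) simp
qed

lemma glauber_irreducible:
  assumes "ip g (g - glauber_matrix \<mu> *v g) \<le> 0"
  shows "\<exists>c. g = c *s 1"
proof -
  have "(\<Sum>i\<in>UNIV. ip g (g - resample i *v g)) \<le> 0"
    using assms by (simp add: glauber_dirichlet divide_le_0_iff)
  then have "(\<Sum>i\<in>UNIV. ip g (g - resample i *v g)) = 0"
    by (intro antisym sum_nonneg resample_dirichlet_nonneg)
  then have "ip g (g - resample i *v g) = 0" for i
    by (subst (asm) sum_nonneg_eq_0_iff) (auto simp: resample_dirichlet_nonneg)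
  then show ?thesis
    by (intro const_if_resample_invariant resample_dirichlet_eq_0)
qed

section \<open>Linear statistics and the correlation matrix\<close>

definition marginal :: "'n \<times> spin \<Rightarrow> real" where
  "marginal p = measure_pmf.prob \<mu> {\<sigma>. \<sigma> (fst p) = snd p}"

definition spin_indicator :: "'n \<times> spin \<Rightarrow> real ^ ('n \<Rightarrow> spin)" where
  "spin_indicator p = (\<chi> \<sigma>. if \<sigma> (fst p) = snd p then 1 else 0)"

definition centred_indicator :: "'n \<times> spin \<Rightarrow> real ^ ('n \<Rightarrow> spin)" where
  "centred_indicator p = spin_indicator p - marginal p *s 1"

lemma marginal_pos: "0 < marginal p"
  unfolding marginal_def
  by (rule measure_pmf_posI [of "\<lambda>_. snd p"]) (auto simp: full_support)

lemma ip_1_1: "ip 1 1 = 1"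
  by (simp add: weighted_inner_def sum_pmf)

lemma prob_eq_sum: "measure_pmf.prob \<mu> {\<sigma>. Q \<sigma>} = (\<Sum>\<sigma>\<in>UNIV. if Q \<sigma> then pmf \<mu> \<sigma> else 0)"
  by (simp add: measure_measure_pmf_finite sum.If_cases)

lemma ip_spin_indicator:
  "ip (spin_indicator p) (spin_indicator q) =
     measure_pmf.prob \<mu> {\<sigma>. \<sigma> (fst p) = snd p \<and> \<sigma> (fst q) = snd q}"
  unfolding prob_eq_sum weighted_inner_def
  by (intro sum.cong refl) (simp add: spin_indicator_def)

lemma ip_1_spin_indicator: "ip 1 (spin_indicator p) = marginal p"
  unfolding marginal_def prob_eq_sum weighted_inner_def
  by (intro sum.cong refl) (simp add: spin_indicator_def)

lemma ip_1_centred_indicator: "ip 1 (centred_indicator p) = 0"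
  by (simp add: centred_indicator_def weighted_inner_simps ip_1_1 ip_1_spin_indicator)

text \<open>
  The correlation matrix is the covariance matrix of the indicators of the events \<open>\<sigma>\<^sub>i = s\<close>, with column
  \<open>q\<close> divided by the probability of the event \<open>q\<close>.
\<close>

lemma correlation_matrix_nth:
  "correlation_matrix \<mu> $ p $ q = ip (centred_indicator p) (centred_indicator q) / marginal q"
proof -
  have "ip (centred_indicator p) (centred_indicator q) =
      measure_pmf.prob \<mu> {\<sigma>. \<sigma> (fst p) = snd p \<and> \<sigma> (fst q) = snd q} - marginal p * marginal q"
    by (simp add: centred_indicator_def weighted_inner_simps ip_1_1 ip_1_spin_indicator ip_spin_indicator
        weighted_inner_commute [of _ "spin_indicator p" 1])
  then show ?thesis
    using marginal_pos [of q]
    by (simp add: correlation_matrix_def cond_prob_def marginal_def split_beta field_simps)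
qed

lemma ip_coordinate:
  "ip (\<chi> \<sigma>. c (\<sigma> i)) (\<chi> \<sigma>. c (\<sigma> i)) =
    (\<Sum>s\<in>UNIV. marginal (i, s) * (c s)\<^sup>2)"
proof -
  have "(\<Sum>s\<in>UNIV. marginal (i, s) * (c s)\<^sup>2) =
      (\<Sum>s\<in>UNIV. \<Sum>\<sigma>\<in>UNIV. pmf \<mu> \<sigma> * (if \<sigma> i = s then (c s)\<^sup>2 else 0))"
    by (simp add: ip_1_spin_indicator [symmetric] weighted_inner_def spin_indicator_def sum_distrib_right
        if_distrib [of "\<lambda>x. x * _"] if_distrib [of "\<lambda>x. _ * x"] cong: if_cong)
  also have "\<dots> = (\<Sum>\<sigma>\<in>UNIV. \<Sum>s\<in>UNIV. pmf \<mu> \<sigma> * (if \<sigma> i = s then (c s)\<^sup>2 else 0))"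
    by (rule sum.swap)
  also have "\<dots> = ip (\<chi> \<sigma>. c (\<sigma> i)) (\<chi> \<sigma>. c (\<sigma> i))"
    by (simp add: weighted_inner_def if_distrib [of "\<lambda>x. _ * x"] power2_eq_square mult.assoc cong: if_cong)
  finally show ?thesis by simp
qed

definition linear_statistic :: "('n \<times> spin \<Rightarrow> real) \<Rightarrow> real ^ ('n \<Rightarrow> spin)" where
  "linear_statistic a = (\<Sum>p\<in>UNIV. a p *s centred_indicator p)"

lemma ip_1_linear_statistic: "ip 1 (linear_statistic a) = 0"
  by (simp add: linear_statistic_def weighted_inner_sum_right weighted_inner_scale_right
      ip_1_centred_indicator)

lemma linear_statistic_nth:
  "linear_statistic a $ \<sigma> = (\<Sum>j\<in>UNIV. a (j, \<sigma> j)) - (\<Sum>p\<in>UNIV. a p * marginal p)"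
proof -
  have "(\<Sum>p\<in>UNIV. a p * spin_indicator p $ \<sigma>) =
      (\<Sum>j\<in>UNIV. \<Sum>s\<in>UNIV. a (j, s) * spin_indicator (j, s) $ \<sigma>)"
    by (simp add: sum.cartesian_product)
  also have "\<dots> = (\<Sum>j\<in>UNIV. a (j, \<sigma> j))"
    by (simp add: spin_indicator_def if_distrib cong: if_cong)
  finally show ?thesis
    by (simp add: linear_statistic_def centred_indicator_def sum_subtractf right_diff_distrib)
qed

text \<open>
  When only spin \<open>i\<close> changes, a linear statistic changes as its \<open>i\<close>-th summand does. So its
  conditional variance given the other spins is at most the second moment of that summand.
\<close>

lemma linear_statistic_dirichlet_le:
  "ip (linear_statistic a) (linear_statistic a - resample i *v linear_statistic a)
     \<le> (\<Sum>s\<in>UNIV. marginal (i, s) * (a (i, s))\<^sup>2)"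
proof -
  have "ip (linear_statistic a) (linear_statistic a - resample i *v linear_statistic a) =
     ip (\<chi> \<sigma>. a (i, \<sigma> i)) ((\<chi> \<sigma>. a (i, \<sigma> i)) - resample i *v (\<chi> \<sigma>. a (i, \<sigma> i)))"
  proof (rule resample_dirichlet_cong)
    fix \<sigma> \<tau> assume "\<tau> \<in> agree_off i \<sigma>"
    then have "(\<Sum>j\<in>-{i}. a (j, \<sigma> j)) = (\<Sum>j\<in>-{i}. a (j, \<tau> j))"
      by (intro sum.cong) (auto simp: agree_off_def)
    then show "linear_statistic a $ \<sigma> - linear_statistic a $ \<tau> =
        (\<chi> \<sigma>. a (i, \<sigma> i)) $ \<sigma> - (\<chi> \<sigma>. a (i, \<sigma> i)) $ \<tau>"
      by (simp add: linear_statistic_nth sum.remove [of UNIV i] Compl_eq_Diff_UNIV)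
  qed
  also have "\<dots> \<le> ip (\<chi> \<sigma>. a (i, \<sigma> i)) (\<chi> \<sigma>. a (i, \<sigma> i))"
    by (rule resample_dirichlet_le)
  also have "\<dots> = (\<Sum>s\<in>UNIV. marginal (i, s) * (a (i, s))\<^sup>2)"
    by (rule ip_coordinate)
  finally show ?thesis .
qed

text \<open>
  The factor \<open>1 / n\<close> is the probability that Glauber dynamics selects a given coordinate.
\<close>

lemma spectral_gap_linear_statistic:
  "spectral_gap (glauber_matrix \<mu>) * ip (linear_statistic a) (linear_statistic a)
     \<le> (\<Sum>p\<in>UNIV. marginal p * (a p)\<^sup>2) / real CARD('n)"
proof -
  have "spectral_gap (glauber_matrix \<mu>) * ip (linear_statistic a) (linear_statistic a)
      \<le> ip (linear_statistic a) (linear_statistic a - glauber_matrix \<mu> *v linear_statistic a)"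
    by (intro glauber.poincare_inequality glauber_irreducible ip_1_linear_statistic)
  also have "\<dots> \<le> (\<Sum>i\<in>UNIV. \<Sum>s\<in>UNIV. marginal (i, s) * (a (i, s))\<^sup>2) / real CARD('n)"
    unfolding glauber_dirichlet
    by (intro divide_right_mono sum_mono linear_statistic_dirichlet_le) simp
  also have "(\<Sum>i\<in>UNIV. \<Sum>s\<in>UNIV. marginal (i, s) * (a (i, s))\<^sup>2) = (\<Sum>p\<in>UNIV. marginal p * (a p)\<^sup>2)"
    by (simp add: sum.cartesian_product)
  finally show ?thesis .
qed

text \<open>
  Substituting \<open>v\<^sub>p = a\<^sub>p marginal p\<close> turns the eigenvalue equation into the generalized
  eigenvalue problem \<open>Cov a = \<theta> D a\<close>, with \<open>Cov\<close> the covariance matrix of the indicators and \<open>D\<close> the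
  diagonal matrix of the marginals. Pair it with \<open>a\<close>.
\<close>

lemma ip_linear_statistic_eigenvector:
  assumes "correlation_matrix \<mu> *v v = \<theta> *s v"
  defines "a \<equiv> \<lambda>p. v $ p / marginal p"
  shows "ip (linear_statistic a) (linear_statistic a) = \<theta> * (\<Sum>p\<in>UNIV. marginal p * (a p)\<^sup>2)"
proof -
  have "ip (centred_indicator p) (linear_statistic a) = \<theta> * v $ p" for p
  proof -
    have "ip (centred_indicator p) (linear_statistic a) = (correlation_matrix \<mu> *v v) $ p"
      by (simp add: linear_statistic_def weighted_inner_sum_right weighted_inner_simps a_def
          matrix_vector_mult_def correlation_matrix_nth mult_ac)
    then show ?thesis by (simp add: assms)
  qed
  moreover have "ip (linear_statistic a) h = (\<Sum>p\<in>UNIV. a p * ip (centred_indicator p) h)" for h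
    by (simp add: linear_statistic_def weighted_inner_sum_left weighted_inner_simps)
  moreover have "a p * (\<theta> * v $ p) = \<theta> * (marginal p * (a p)\<^sup>2)" for p
    using marginal_pos [of p] by (simp add: a_def power2_eq_square)
  ultimately show ?thesis
    by (simp only: sum_distrib_left)
qed

text \<open>
  For every configuration exactly \<open>n\<close> of the indicators equal 1, so the centred indicators add up to 0.
  This provides a real eigenvalue, without which the head of the eigenvalue list would be an
  unspecified number.
\<close>

lemma correlation_matrix_singular: "0 \<in> set (eigenvalues (correlation_matrix \<mu>))"
proof -
  define v :: "real ^ ('n \<times> spin)" where "v = (\<chi> p. marginal p)"
  have "(\<Sum>q\<in>UNIV. centred_indicator q) = 0"
  proof -
    \<comment> \<open>The statistic with all coefficients 1 is constant, and it has mean zero.\<close>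
    define c where "c = real CARD('n) - (\<Sum>p\<in>UNIV. marginal p)"
    have const: "linear_statistic (\<lambda>_. 1) = c *s 1"
      by (simp add: vec_eq_iff linear_statistic_nth c_def)
    then have "c = 0"
      using ip_1_linear_statistic [of "\<lambda>_. 1"] by (simp add: weighted_inner_simps ip_1_1)
    then show ?thesis
      using const by (simp add: linear_statistic_def)
  qed
  then have "(\<Sum>q\<in>UNIV. ip (centred_indicator p) (centred_indicator q)) = 0" for p
    by (simp only: weighted_inner_sum_right [symmetric]) (simp add: weighted_inner_def)
  then have "correlation_matrix \<mu> *v v = 0 *s v"
    using marginal_pos
    by (simp add: vec_eq_iff matrix_vector_mult_def correlation_matrix_nth v_def less_imp_neq [symmetric])
  moreover have "v \<noteq> 0"
    using marginal_pos by (auto simp: v_def vec_eq_iff less_imp_neq [symmetric])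
  ultimately show ?thesis
    unfolding set_eigenvalues by blast
qed

section \<open>The eigenvalue bound\<close>

lemma correlation_eigenvalue_le:
  assumes "\<theta> \<in> set (eigenvalues (correlation_matrix \<mu>))"
    and "C > 0"
    and gap: "spectral_gap (glauber_matrix \<mu>) = 1 / (C * real CARD('n))"
  shows "\<theta> \<le> C"
proof -
  obtain v where v: "v \<noteq> 0" "correlation_matrix \<mu> *v v = \<theta> *s v"
    using assms(1) unfolding set_eigenvalues by blast
  define a where "a = (\<lambda>p. v $ p / marginal p)"
  define N where "N = (\<Sum>p\<in>UNIV. marginal p * (a p)\<^sup>2)"
  obtain p where "v $ p \<noteq> 0" using v(1) by (auto simp: vec_eq_iff)
  then have "N > 0"
    unfolding N_def using marginal_pos
    by (intro sum_pos2 [of _ p]) (auto simp: a_def less_imp_le less_imp_neq [symmetric])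
  have "1 / (C * real CARD('n)) * (\<theta> * N) \<le> N / real CARD('n)"
    using spectral_gap_linear_statistic [of a] ip_linear_statistic_eigenvector [OF v(2)]
    unfolding gap N_def a_def by simp
  then show ?thesis
    using \<open>N > 0\<close> \<open>C > 0\<close> by (simp add: field_simps)
qed

end

theorem theorem1:
  fixes \<mu> :: "('n::finite \<Rightarrow> spin) pmf" and C :: real
  assumes "set_pmf \<mu> = UNIV"
    and "C > 0"
    and "spectral_gap (glauber_matrix \<mu>) = 1 / (C * real CARD('n))"
  shows "spectrally_independent C \<mu>"
proof -
  interpret full_support \<mu> by unfold_locales (rule assms)
  let ?l = "eigenvalues (correlation_matrix \<mu>)"
  have "?l ! 0 \<in> set ?l"
    using correlation_matrix_singular by (intro nth_mem) (auto simp: length_pos_if_in_set)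
  then show ?thesis
    unfolding spectrally_independent_def largest_eigenvalue_def
    by (rule correlation_eigenvalue_le [OF _ assms(2,3)])
qed

end
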